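(* Let $\mathcal{T}$ be a triangle with circumcircle $\mathcal{C}$, let $D$ be a point lying neither on the sides of $\mathcal{T}$ nor on $\mathcal{C}$, let $\mathcal{E}_D$ be the pedal-circle of $\mathcal{T}$ with respect to $D$, and let $\mathcal{E}_D'$ be the inverse of $\mathcal{E}_D$ with respect to an inversion circle $\mathcal{I}$ centred at $D$. Let $A$ be any point on $\mathcal{C}$ and let $a$ be its polar with respect to $\mathcal{I}$. If $a$ is external to $\mathcal{E}_D'$, then there is no triangle with a vertex at $A$ sharing the same circumcircle and pedal-circle with $\mathcal{T}$. Otherwise, let the polar $a$ of $A$ intersect $\mathcal{E}_D'$ in $B_p, C_p$; the polars of $B_p$ and $C_p$ pass through $A$ and intersect $\mathcal{C}$ again in $C$ and $B$, respectively. Then the pedal-circle of the triangle $ABC$ thus constructed is $\mathcal{E}_D$. All triangles that are inscribed in $\mathcal{C}$ and share the same pedal-circle $\mathcal{E}_D$ are obtainable in this manner.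
   Context: All objects are in the Euclidean plane. A "side" of a triangle means the line through two of its vertices. The pedal triangle of a triangle with respect to $D$ has as vertices the projections of $D$ on its sides; the pedal-circle is the circumcircle of the pedal triangle, and all pedal-circles here are with respect to the same point $D$. Poles and polars are taken with respect to the circle $\mathcal{I}$ centred at $D$: the polar of a point $P\neq D$ is the line perpendicular to $DP$ through the inverse of $P$ in $\mathcal{I}$. A line is external to a circle if it does not meet it. *)

theory Defs
  imports "HOL-Analysis.Analysis"
begin

type_synonym point = "real ^ 2"

definition is_triangle :: "point \<Rightarrow> point \<Rightarrow> point \<Rightarrow> bool" where
  "is_triangle A B C \<longleftrightarrow> \<not> collinear {A, B, C}"

definition side_line :: "point \<Rightarrow> point \<Rightarrow> point set" where
  "side_line A B = affine hull {A, B}"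

definition is_circle :: "point set \<Rightarrow> bool" where
  "is_circle S \<longleftrightarrow> (\<exists>c r. r > 0 \<and> S = sphere c r)"

(* Meaningful only when A, B, C are not collinear; the circle is then unique. *)
definition circumcircle :: "point \<Rightarrow> point \<Rightarrow> point \<Rightarrow> point set" where
  "circumcircle A B C = (THE S. is_circle S \<and> {A, B, C} \<subseteq> S)"

(* The closest point of a line is the orthogonal projection on it. *)
definition foot :: "point \<Rightarrow> point \<Rightarrow> point \<Rightarrow> point" where
  "foot D A B = closest_point (side_line A B) D"

(* By Simson's theorem the three feet are not collinear as soon as A B C is a triangle
   and D is not on its circumcircle. *)
definition pedal_circle :: "point \<Rightarrow> point \<Rightarrow> point \<Rightarrow> point \<Rightarrow> point set" where
  "pedal_circle D A B C = circumcircle (foot D B C) (foot D C A) (foot D A B)"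

(* Inversion in sphere D r; the centre, where inversion is undefined, is sent to itself. *)
definition inversion :: "point \<Rightarrow> real \<Rightarrow> point \<Rightarrow> point" where
  "inversion D r P = D + (r\<^sup>2 / (dist D P)\<^sup>2) *\<^sub>R (P - D)"

(* The centre is left out, as it has no inverse. *)
definition inverse_curve :: "point \<Rightarrow> real \<Rightarrow> point set \<Rightarrow> point set" where
  "inverse_curve D r S = inversion D r ` (S - {D})"

(* Polar of P with respect to sphere D r, for P different from D. *)
definition polar :: "point \<Rightarrow> real \<Rightarrow> point \<Rightarrow> point set" where
  "polar D r P = {X. (X - inversion D r P) \<bullet> (P - D) = 0}"

(* K is the circumcircle, E' the inverse of the pedal circle. A two-element set
   {X, Y} with X = Y describes a tangent line, so that the "other" intersection of a line
   through A with K is A itself when the line is tangent to K. *)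
definition polar_construction ::
  "point \<Rightarrow> real \<Rightarrow> point set \<Rightarrow> point set \<Rightarrow>
   point \<Rightarrow> point \<Rightarrow> point \<Rightarrow> point \<Rightarrow> point \<Rightarrow> bool" where
  "polar_construction D r K E' A Bp Cp B C \<longleftrightarrow>
     polar D r A \<inter> E' = {Bp, Cp} \<and>
     polar D r Bp \<inter> K = {A, C} \<and>
     polar D r Cp \<inter> K = {A, B}"

end

theory Submission
  imports Defs
begin

text \<open>
  Scale the plane so that the circumcircle becomes the unit circle of the complex numbers, and
  write d for the image of D. The foot of d on the chord through the unit numbers a and b is
  (d + a + b - a b cnj d) / 2, which is symmetric in a and b.

  Every triangle a, b, c on the unit circle has an isogonal conjugate z of d, characterised by
  d + z + a b c cnj d cnj z = a + b + c, and its pedal circle is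
  |2 f - d - z| = |1 - cnj d z|. So d and the centre (d + z) / 2 of the pedal circle
  determine its radius (lemma \<open>focal_of_triangle\<close>). This is the circle with diameter the
  focal axis of the conic with foci d and z inscribed in the triangle.

  The theorem is then a case of Poncelet's closure. For fixed d, z and fixed a on the unit circle,
  the condition that the foot on the chord a b lies on this circle is a quadratic
  equation in b. If b and c are two different roots, then Vieta's formulas express b + c and b c
  through a, d, z, and for these values the foot on the chord b c satisfies the condition too
  (lemma \<open>focal_closure\<close>). This needs z off the unit circle. If z were on it, z would be a vertex
  of the given triangle and D would lie on the opposite side (lemma \<open>conjugate_on_circle\<close>). The
  same condition keeps D off the pedal circle (lemma \<open>on_focal_self\<close>), so inversion is
  harmless on that circle.

  Polarity only rephrases this. The polar of the inverse of F is the line through F perpendicular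
  to DF. So a point of the inverted pedal circle lies on the polar of A exactly when it is the
  inverse of a point F of the pedal circle for which that line passes through A; F is then the
  foot of D on the line, and the second intersection of the line with the
  circumcircle is a root of the quadratic equation above. These points F also lie
  on the circle with diameter DA (lemma \<open>polar_inverse_no_three\<close>), so there are at most two of them.
\<close>

section \<open>Circles and lines in the plane\<close>

lemma orthogonal_plane:
  fixes n u :: point
  assumes "n \<noteq> 0" "u \<bullet> n = 0"
  shows "\<exists>k. u = k *\<^sub>R vector [- (n$2), n$1]"
proof
  have nn: "(n$1)\<^sup>2 + (n$2)\<^sup>2 \<noteq> 0"
    using assms(1) by (simp add: vec_eq_iff forall_2 sum_power2_eq_zero_iff)
  have e: "u$1 * n$1 + u$2 * n$2 = 0"
    using assms(2) by (simp add: inner_vec_def sum_2)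
  have "u$1 * ((n$1)\<^sup>2 + (n$2)\<^sup>2) = (u$2 * n$1 - u$1 * n$2) * (- (n$2))"
    "u$2 * ((n$1)\<^sup>2 + (n$2)\<^sup>2) = (u$2 * n$1 - u$1 * n$2) * n$1"
    using e by algebra+
  then show "u = ((u$2 * n$1 - u$1 * n$2) / ((n$1)\<^sup>2 + (n$2)\<^sup>2)) *\<^sub>R vector [- (n$2), n$1]"
    using nn by (simp add: vec_eq_iff forall_2) (simp add: field_simps)
qed

lemma sphere_line_no_three:
  fixes X Y Z n c :: point
  assumes "n \<noteq> 0" "X \<in> sphere c \<rho>" "Y \<in> sphere c \<rho>" "Z \<in> sphere c \<rho>"
    and "(X - Y) \<bullet> n = 0" "(X - Z) \<bullet> n = 0"
  shows "X = Y \<or> X = Z \<or> Y = Z"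
proof -
  define t :: point where "t = vector [- (n$2), n$1]"
  have "t \<noteq> 0" using assms(1) by (auto simp: t_def vec_eq_iff forall_2)
  then have tt: "t \<bullet> t \<noteq> 0" by simp
  have par: "\<exists>k. W = X + k *\<^sub>R t" if W: "(X - W) \<bullet> n = 0" for W
  proof -
    have "(W - X) \<bullet> n = 0" using W by (simp add: inner_diff_left)
    then obtain k where "W - X = k *\<^sub>R t" using orthogonal_plane assms(1) t_def by blast
    then show ?thesis by (metis add.commute diff_add_cancel)
  qed
  obtain k where k: "Y = X + k *\<^sub>R t" using par assms(5) by blast
  obtain l where l: "Z = X + l *\<^sub>R t" using par assms(6) by blast
  have sph: "(W - c) \<bullet> (W - c) = \<rho>\<^sup>2" if "W \<in> sphere c \<rho>" for W
    using that by (simp add: dist_norm norm_minus_commute flip: power2_norm_eq_inner)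
  have root: "k * (2 * ((X - c) \<bullet> t) + k * (t \<bullet> t)) = 0" if "X + k *\<^sub>R t \<in> sphere c \<rho>" for k
    using sph[OF that] sph[OF assms(2)]
    by (simp add: inner_diff_left inner_diff_right inner_add_left inner_add_right algebra_simps
        inner_commute)
  have rk: "k = 0 \<or> 2 * ((X - c) \<bullet> t) + k * (t \<bullet> t) = 0"
    using root[of k] assms(3) k by simp
  have rl: "l = 0 \<or> 2 * ((X - c) \<bullet> t) + l * (t \<bullet> t) = 0"
    using root[of l] assms(4) l by simp
  have "k = 0 \<or> l = 0 \<or> k * (t \<bullet> t) = l * (t \<bullet> t)"
    using rk rl by linarith
  then show ?thesis using k l tt by auto
qed

text \<open>All common points of two circles lie on a line perpendicular to the line of centres.\<close>
lemma two_spheres_no_three: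
  fixes X Y Z c c' :: point
  assumes "X \<in> sphere c \<rho> \<inter> sphere c' \<rho>'" "Y \<in> sphere c \<rho> \<inter> sphere c' \<rho>'"
    "Z \<in> sphere c \<rho> \<inter> sphere c' \<rho>'" and "c \<noteq> c'"
  shows "X = Y \<or> X = Z \<or> Y = Z"
proof -
  have sph: "(W - c) \<bullet> (W - c) = \<rho>\<^sup>2" if "W \<in> sphere c \<rho>" for W c \<rho>
    using that by (simp add: dist_norm norm_minus_commute flip: power2_norm_eq_inner)
  have "(W - V) \<bullet> (c - c') = 0"
    if "W \<in> sphere c \<rho> \<inter> sphere c' \<rho>'" "V \<in> sphere c \<rho> \<inter> sphere c' \<rho>'" for W V
    using sph[of W c \<rho>] sph[of W c' \<rho>'] sph[of V c \<rho>] sph[of V c' \<rho>'] that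
    by (simp add: inner_diff_left inner_diff_right inner_commute)
  then show ?thesis
    using sphere_line_no_three[of "c - c'" X c \<rho> Y Z] assms by auto
qed

lemma circumcircle_eqI:
  assumes "0 < \<rho>" "{X, Y, Z} \<subseteq> sphere c \<rho>" "X \<noteq> Y" "Y \<noteq> Z" "Z \<noteq> X"
  shows "circumcircle X Y Z = sphere c \<rho>"
  unfolding circumcircle_def
proof (rule the_equality)
  show "is_circle (sphere c \<rho>) \<and> {X, Y, Z} \<subseteq> sphere c \<rho>"
    using assms by (auto simp: is_circle_def)
next
  fix S assume S: "is_circle S \<and> {X, Y, Z} \<subseteq> S"
  then obtain c' \<rho>' where S': "S = sphere c' \<rho>'" by (auto simp: is_circle_def)
  have "c = c'"
    using two_spheres_no_three[of X c \<rho> c' \<rho>' Y Z] S S' assms by auto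
  moreover from this have "\<rho> = \<rho>'" using S S' assms(2) by auto
  ultimately show "S = sphere c \<rho>" using S' by simp
qed

lemma not_collinear_on_sphere:
  fixes X Y Z c :: point
  assumes "{X, Y, Z} \<subseteq> sphere c \<rho>" "X \<noteq> Y" "Y \<noteq> Z" "Z \<noteq> X"
  shows "is_triangle X Y Z"
  unfolding is_triangle_def
proof
  assume "collinear {X, Y, Z}"
  then obtain u where u: "\<And>x y. x \<in> {X, Y, Z} \<Longrightarrow> y \<in> {X, Y, Z} \<Longrightarrow> \<exists>c. x - y = c *\<^sub>R u"
    unfolding collinear_def by blast
  obtain k l where k: "X - Y = k *\<^sub>R u" and l: "X - Z = l *\<^sub>R u" using u by blast
  have "u \<noteq> 0" using k assms by auto
  define n :: point where "n = vector [- (u$2), u$1]"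
  have n: "n$1 = - (u$2)" "n$2 = u$1" by (simp_all add: n_def)
  have "n \<noteq> 0" using \<open>u \<noteq> 0\<close> by (auto simp: vec_eq_iff forall_2 n)
  moreover have "u \<bullet> n = 0" by (simp add: inner_vec_def sum_2 n)
  ultimately show False
    using sphere_line_no_three[of n X c \<rho> Y Z] assms k l by auto
qed

text \<open>The circumcentre is written down by Cramer's rule for the equations of two perpendicular
  bisectors; the determinant D below is twice the signed area.\<close>
lemma triangle_on_sphere:
  assumes "is_triangle X Y Z"
  shows "X \<noteq> Y" "Y \<noteq> Z" "Z \<noteq> X" "\<exists>c \<rho>. 0 < \<rho> \<and> {X, Y, Z} \<subseteq> sphere c \<rho>"
proof -
  show XY: "X \<noteq> Y" and "Y \<noteq> Z" and "Z \<noteq> X"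
    using assms by (auto simp: is_triangle_def insert_commute)
  define D where "D = (Y$1 - X$1) * (Z$2 - X$2) - (Y$2 - X$2) * (Z$1 - X$1)"
  have "D \<noteq> 0"
  proof
    assume "D = 0"
    have "Z - X = (((Z - X) \<bullet> (Y - X)) / ((Y - X) \<bullet> (Y - X))) *\<^sub>R (Y - X)"
    proof -
      have nz: "(Y$1 - X$1) * (Y$1 - X$1) + (Y$2 - X$2) * (Y$2 - X$2) \<noteq> 0"
        using XY by (auto simp: vec_eq_iff forall_2 sum_squares_eq_zero_iff)
      have "(Z$1 - X$1) * ((Y$1 - X$1) * (Y$1 - X$1) + (Y$2 - X$2) * (Y$2 - X$2)) =
        ((Z$1 - X$1) * (Y$1 - X$1) + (Z$2 - X$2) * (Y$2 - X$2)) * (Y$1 - X$1)"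
       "(Z$2 - X$2) * ((Y$1 - X$1) * (Y$1 - X$1) + (Y$2 - X$2) * (Y$2 - X$2)) =
        ((Z$1 - X$1) * (Y$1 - X$1) + (Z$2 - X$2) * (Y$2 - X$2)) * (Y$2 - X$2)"
        using \<open>D = 0\<close> unfolding D_def by algebra+
      then show ?thesis
        using nz by (simp add: vec_eq_iff forall_2 inner_vec_def sum_2 eq_divide_eq)
    qed
    then have "collinear {0, Y - X, Z - X}" by (metis collinear_lemma)
    then have "collinear {Y, X, Z}" by (simp add: collinear_3)
    then show False using assms by (simp add: is_triangle_def insert_commute)
  qed
  define y z where "y = (Y - X) \<bullet> (Y - X)" and "z = (Z - X) \<bullet> (Z - X)"
  define c :: point where "c = X + vector [((Z$2 - X$2) * y - (Y$2 - X$2) * z) / (2 * D),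
    ((Y$1 - X$1) * z - (Z$1 - X$1) * y) / (2 * D)]"
  have c: "2 * D * (c$1 - X$1) = (Z$2 - X$2) * y - (Y$2 - X$2) * z"
    "2 * D * (c$2 - X$2) = (Y$1 - X$1) * z - (Z$1 - X$1) * y"
    using \<open>D \<noteq> 0\<close> by (simp_all add: c_def)
  have yz: "y = (Y$1 - X$1) * (Y$1 - X$1) + (Y$2 - X$2) * (Y$2 - X$2)"
    "z = (Z$1 - X$1) * (Z$1 - X$1) + (Z$2 - X$2) * (Z$2 - X$2)"
    by (simp_all add: y_def z_def inner_vec_def sum_2)
  have "D * (2 * ((c$1 - X$1) * (Y$1 - X$1) + (c$2 - X$2) * (Y$2 - X$2))) = D * y"
    "D * (2 * ((c$1 - X$1) * (Z$1 - X$1) + (c$2 - X$2) * (Z$2 - X$2))) = D * z"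
    using c D_def by algebra+
  then have "2 * ((c$1 - X$1) * (Y$1 - X$1) + (c$2 - X$2) * (Y$2 - X$2)) = y"
    "2 * ((c$1 - X$1) * (Z$1 - X$1) + (c$2 - X$2) * (Z$2 - X$2)) = z"
    using \<open>D \<noteq> 0\<close> mult_cancel_left by blast+
  then have "dist c Y = dist c X" "dist c Z = dist c X"
    by (simp_all add: dist_norm norm_eq inner_vec_def sum_2 yz algebra_simps)
  moreover have "dist c X > 0" using XY calculation by (metis dist_eq_0_iff zero_less_dist_iff)
  ultimately show "\<exists>c \<rho>. 0 < \<rho> \<and> {X, Y, Z} \<subseteq> sphere c \<rho>"
    by (intro exI[of _ c] exI[of _ "dist c X"]) auto
qed

section \<open>Feet of perpendiculars\<close>

text \<open>Pythagoras: the distance from D to a point Z of the line splits into DF and FZ.\<close>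
lemma foot_eqI:
  assumes "F \<in> side_line A B" "(D - F) \<bullet> (B - A) = 0"
  shows "foot D A B = F"
  unfolding foot_def
proof (rule closest_point_unique[symmetric])
  show "convex (side_line A B)" "closed (side_line A B)"
    by (simp_all add: side_line_def affine_imp_convex closed_affine_hull)
  show "\<forall>Z\<in>side_line A B. dist D F \<le> dist D Z"
  proof
    fix Z assume "Z \<in> side_line A B"
    then obtain u where Z: "Z = A + u *\<^sub>R (B - A)"
      by (auto simp: side_line_def affine_hull_2_alt)
    obtain v where F: "F = A + v *\<^sub>R (B - A)"
      using assms by (auto simp: side_line_def affine_hull_2_alt)
    have ZF: "Z - F = (u - v) *\<^sub>R (B - A)" by (simp add: Z F algebra_simps)
    have "(dist D Z)\<^sup>2 = (norm ((D - F) - (Z - F)))\<^sup>2" by (simp add: dist_norm)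
    also have "\<dots> = (dist D F)\<^sup>2 + (norm (Z - F))\<^sup>2 - 2 * ((D - F) \<bullet> (Z - F))"
      unfolding dist_norm power2_norm_eq_inner
      by (simp only: inner_diff_left[of "D-F" "Z-F"] inner_diff_right[of _ "D-F" "Z-F"] inner_commute[of "Z-F" "D-F"])
    also have "(D - F) \<bullet> (Z - F) = 0" using assms(2) by (simp add: ZF)
    finally show "dist D F \<le> dist D Z"
      by (simp add: power2_le_imp_le)
  qed
qed fact

lemma foot_props:
  assumes "A \<noteq> B"
  shows "foot D A B = A + (((D - A) \<bullet> (B - A)) / ((B - A) \<bullet> (B - A))) *\<^sub>R (B - A)"
    and "(D - foot D A B) \<bullet> (B - A) = 0"
    and "foot D A B \<in> side_line A B"
proof -
  define F where "F = A + (((D - A) \<bullet> (B - A)) / ((B - A) \<bullet> (B - A))) *\<^sub>R (B - A)"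
  have F1: "F \<in> side_line A B" by (auto simp: side_line_def affine_hull_2_alt F_def)
  have "(D - F) \<bullet> (B - A) = (D - A) \<bullet> (B - A) 
     - (((D - A) \<bullet> (B - A)) / ((B - A) \<bullet> (B - A))) * ((B - A) \<bullet> (B - A))"
    by (simp only: F_def inner_diff_left inner_add_left inner_scaleR_left diff_add_eq_diff_diff_swap)
  also have "\<dots> = 0" using assms by simp
  finally have F2: "(D - F) \<bullet> (B - A) = 0" .
  have "foot D A B = F" using F1 F2 by (rule foot_eqI)
  then show "foot D A B = A + (((D - A) \<bullet> (B - A)) / ((B - A) \<bullet> (B - A))) *\<^sub>R (B - A)" 
    "(D - foot D A B) \<bullet> (B - A) = 0" "foot D A B \<in> side_line A B"
    using F1 F2 F_def by auto
qed


lemma foot_commute: "foot D A B = foot D B A"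
  by (simp add: foot_def side_line_def insert_commute)

lemma foot_eqI_orthogonal:
  assumes "A \<noteq> B" "F \<noteq> D" "(A - F) \<bullet> (F - D) = 0" "(B - F) \<bullet> (F - D) = 0"
  shows "foot D A B = F"
proof (rule foot_eqI)
  define t :: point where "t = vector [- ((F - D)$2), (F - D)$1]"
  obtain k l where k: "A - F = k *\<^sub>R t" and l: "B - F = l *\<^sub>R t"
    using orthogonal_plane[of "F - D"] assms t_def by (metis right_minus_eq)
  have AB: "B - A = (l - k) *\<^sub>R t" using k l by (simp add: algebra_simps)
  then have "l \<noteq> k" using assms(1) by auto
  have "F = A + (k / (k - l)) *\<^sub>R (B - A)"
  proof -
    have "(k / (k - l)) *\<^sub>R (B - A) = - (k *\<^sub>R t)"
    proof -
      have "k / (k - l) * (l - k) = - k" using \<open>l \<noteq> k\<close> by (simp add: field_simps)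
      then show ?thesis by (simp add: AB)
    qed
    then show ?thesis using k by (simp add: algebra_simps)
  qed
  then show "F \<in> side_line A B" unfolding side_line_def affine_hull_2_alt by blast
  have "(B - A) \<bullet> (F - D) = 0"
    using assms(3,4) by (simp add: inner_diff_left)
  then show "(D - F) \<bullet> (B - A) = 0"
    by (simp add: inner_commute inner_diff_left inner_diff_right)
qed

section \<open>Triangles inscribed in the complex unit circle\<close>

lemma unit_cnj: "cmod a = 1 \<Longrightarrow> a * cnj a = 1"
  by (simp add: complex_norm_square[symmetric])

lemma cmod_eq_iff: "cmod x = cmod y \<longleftrightarrow> x * cnj x = y * cnj y"
  unfolding complex_norm_square[symmetric] of_real_eq_iff by (simp add: power2_eq_iff_nonneg)

text \<open>For \<open>e1 = a + b + c\<close> and \<open>e3 = a b c\<close> the number z is the isogonal conjugate of d in the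
  triangle a, b, c. The equation is real-linear in z; eliminating \<open>cnj z\<close> with the
  conjugate equation leaves the factor 1 - |d|^2.\<close>
lemma isogonal_conjugate_exists:
  fixes d e :: complex
  assumes e3: "cmod e3 = 1" and d: "cmod d \<noteq> 1"
  obtains z where "d + z + e3 * cnj d * cnj z = e1"
proof -
  define z where "z = (e1 - d - e3 * cnj d * (cnj e1 - cnj d)) / (1 - d * cnj d)"
  have n: "1 - d * cnj d \<noteq> 0"
  proof
    assume "1 - d * cnj d = 0"
    then have "cmod d = cmod 1" unfolding cmod_eq_iff by simp
    then show False using d by simp
  qed
  have z1: "z * (1 - d * cnj d) = e1 - d - e3 * cnj d * (cnj e1 - cnj d)"
    using n by (simp add: z_def)
  from arg_cong[OF this, of cnj]
  have z2: "cnj z * (1 - d * cnj d) = cnj e1 - cnj d - cnj e3 * d * (e1 - d)"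
    by (simp add: mult.commute)
  have "(d + z + e3 * cnj d * cnj z) * (1 - d * cnj d) = e1 * (1 - d * cnj d)"
    using z1 z2 unit_cnj[OF e3] by algebra
  then show ?thesis using n that by auto
qed

definition chord_foot :: "complex \<Rightarrow> complex \<Rightarrow> complex \<Rightarrow> complex" where
  "chord_foot d a b = (d + a + b - a * b * cnj d) / 2"

text \<open>The circle with centre (d + z) / 2 and radius |1 - cnj d z| / 2, as a condition on f. It is the
  locus of the feet of d on the tangents of a conic with foci d and z and focal axis
  |1 - cnj d z|, the conic inscribed in the triangles considered here.\<close>
definition on_focal :: "complex \<Rightarrow> complex \<Rightarrow> complex \<Rightarrow> bool" where
  "on_focal d z f \<longleftrightarrow> cmod (2 * f - d - z) = cmod (1 - cnj d * z)"

text \<open>On the unit circle conjugation is inversion, so multiplication by a b turns the equality of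
  moduli into a polynomial condition, quadratic in each of a and b.\<close>
lemma on_focal_chord_foot:
  assumes "cmod a = 1" "cmod b = 1"
  shows "on_focal d z (chord_foot d a b) \<longleftrightarrow>
    (a + b - z - a * b * cnj d) * (a + b - d - a * b * cnj z) =
    a * b * (1 - cnj d * z) * (1 - d * cnj z)"
proof -
  have a: "a * cnj a = 1" and b: "b * cnj b = 1" using assms unit_cnj by auto
  have nz: "a * b \<noteq> 0" using assms by auto
  define u v where "u = (a + b - z - a * b * cnj d)" and "v = (1 - cnj d * z)"
  have "2 * chord_foot d a b - d - z = u"
    by (simp add: chord_foot_def u_def del: distrib_left_numeral right_diff_distrib_numeral)
  then have "on_focal d z (chord_foot d a b) \<longleftrightarrow> cmod u = cmod v"
    by (simp add: on_focal_def v_def)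
  also have "\<dots> \<longleftrightarrow> u * cnj u = v * cnj v" by (rule cmod_eq_iff)
  also have "\<dots> \<longleftrightarrow> a * b * (u * cnj u) = a * b * (v * cnj v)" using nz by simp
  also have "a * b * (u * cnj u) = (a + b - z - a * b * cnj d) * (a + b - d - a * b * cnj z)"
    unfolding u_def using a b by simp algebra
  also have "a * b * (v * cnj v) = a * b * (1 - cnj d * z) * (1 - d * cnj z)"
    by (simp add: v_def)
  finally show ?thesis .
qed

text \<open>The equation for z and its conjugate give
  b c (1 - a cnj d) (1 - a cnj z) = (a - d) (a - z). With it the left-hand side of the
  polynomial condition, after b + c is eliminated, factors as required.\<close>
lemma focal_of_triangle:
  assumes "cmod a = 1" "cmod b = 1" "cmod c = 1"
    and z: "d + z + a * b * c * cnj d * cnj z = a + b + c"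
  shows "on_focal d z (chord_foot d b c)"
proof -
  have a: "a * cnj a = 1" and b: "b * cnj b = 1" and c: "c * cnj c = 1" using assms unit_cnj by auto
  have z2: "a * b * c * (cnj d + cnj z) + d * z = a * b + b * c + c * a"
    using arg_cong[OF z, of cnj] a b c by simp algebra
  have p: "b * c * (1 - a * cnj d) * (1 - a * cnj z) = (a - d) * (a - z)"
    using z z2 by algebra
  have s: "b + c = d + z + a * (b * c) * cnj d * cnj z - a"
    using z by algebra
  show ?thesis
    unfolding on_focal_chord_foot[OF assms(2,3)]
    using s p by algebra
qed

text \<open>Poncelet closure. The polynomial condition on b, for fixed a, reads
  \<alpha> b^2 + \<beta> b + \<gamma> = 0, and c is the other root. Vieta's formulas turn the
  condition for b and c, multiplied by \<alpha>^2, into an identity in a, d, z and their conjugates.\<close>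
lemma focal_closure:
  assumes abc: "cmod a = 1" "cmod b = 1" "cmod c = 1" and "b \<noteq> c"
    and d: "cmod d \<noteq> 1" and z: "cmod z \<noteq> 1"
    and ab: "on_focal d z (chord_foot d a b)" and ac: "on_focal d z (chord_foot d a c)"
  shows "on_focal d z (chord_foot d b c)"
proof -
  define \<alpha> where "\<alpha> = (1 - a * cnj d) * (1 - a * cnj z)"
  define \<gamma> where "\<gamma> = (a - d) * (a - z)"
  define \<beta> where "\<beta> = (1 - a * cnj d) * (a - d) + (a - z) * (1 - a * cnj z)
    - a * (1 - cnj d * z) * (1 - d * cnj z)"
  have "\<alpha> * b\<^sup>2 + \<beta> * b + \<gamma> = 0" "\<alpha> * c\<^sup>2 + \<beta> * c + \<gamma> = 0"
    using ab ac unfolding on_focal_chord_foot[OF abc(1,2)] on_focal_chord_foot[OF abc(1,3)]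
      \<alpha>_def \<beta>_def \<gamma>_def by algebra+
  then have "(b - c) * (\<alpha> * (b + c) + \<beta>) = 0" "(b - c) * (\<alpha> * (b * c) - \<gamma>) = 0"
    by algebra+
  then have s: "\<alpha> * (b + c) = - \<beta>" and p: "\<alpha> * (b * c) = \<gamma>"
    using \<open>b \<noteq> c\<close> by (auto simp: eq_neg_iff_add_eq_0)
  have nz: "1 - a * cnj w \<noteq> 0" if "cmod w \<noteq> 1" for w
  proof
    assume "1 - a * cnj w = 0"
    then have "cmod (a * cnj w) = 1" by (metis eq_iff_diff_eq_0 norm_one)
    then show False using that abc by (simp add: norm_mult)
  qed
  have "\<alpha> \<noteq> 0" unfolding \<alpha>_def using nz d z by simp
  have "(\<alpha> * (b + c) - \<alpha> * z - \<alpha> * (b * c) * cnj d) * (\<alpha> * (b + c) - \<alpha> * d - \<alpha> * (b * c) * cnj z)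
    = \<alpha> * (\<alpha> * (b * c)) * (1 - cnj d * z) * (1 - d * cnj z)"
    unfolding s p unfolding \<alpha>_def \<beta>_def \<gamma>_def by algebra
  then have "\<alpha> * \<alpha> * ((b + c - z - b * c * cnj d) * (b + c - d - b * c * cnj z))
    = \<alpha> * \<alpha> * (b * c * (1 - cnj d * z) * (1 - d * cnj z))"
    by algebra
  then show ?thesis
    unfolding on_focal_chord_foot[OF abc(2,3)] using \<open>\<alpha> \<noteq> 0\<close> by simp
qed

text \<open>If |z| = 1, then eliminating d and its conjugate from the equation for z leaves
  (z - a) (z - b) (z - c) = 0, and for z = a that equation says that d lies on the chord b c.\<close>
lemma conjugate_on_circle:
  assumes "cmod a = 1" "cmod b = 1" "cmod c = 1" "cmod z = 1"
    and z: "d + z + a * b * c * cnj d * cnj z = a + b + c"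
  shows "chord_foot d b c = d \<or> chord_foot d c a = d \<or> chord_foot d a b = d"
proof -
  have a: "a * cnj a = 1" and b: "b * cnj b = 1" and c: "c * cnj c = 1" and zz: "z * cnj z = 1"
    using assms unit_cnj by auto
  have z2: "a * b * c * (cnj d + cnj z) + d * z = a * b + b * c + c * a"
    using arg_cong[OF z, of cnj] a b c by simp algebra
  have "(z - a) * (z - b) * (z - c) = 0"
    using z z2 zz by algebra
  then consider "z = a" | "z = b" | "z = c" by auto
  then show ?thesis
  proof cases
    case 1
    have "d + b * c * cnj d = b + c" using z[unfolded 1] a by algebra
    then show ?thesis by (simp add: chord_foot_def field_simps)
  next
    case 2
    have "d + a * c * cnj d = a + c" using z[unfolded 2] b by algebra
    then show ?thesis by (simp add: chord_foot_def field_simps)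
  next
    case 3
    have "d + a * b * cnj d = a + b" using z[unfolded 3] c by algebra
    then show ?thesis by (simp add: chord_foot_def field_simps)
  qed
qed

text \<open>Because |1 - cnj d z|^2 - |d - z|^2 = (1 - |d|^2) (1 - |z|^2).\<close>
lemma on_focal_self:
  assumes "on_focal d z d"
  shows "cmod d = 1 \<or> cmod z = 1"
proof -
  have "(d - z) * cnj (d - z) = (1 - cnj d * z) * cnj (1 - cnj d * z)"
    using assms unfolding on_focal_def cmod_eq_iff by simp
  then have "(1 - d * cnj d) * (1 - z * cnj z) = 0" by simp algebra
  then have "d * cnj d = 1 * cnj 1 \<or> z * cnj z = 1 * cnj 1" by auto
  then show ?thesis unfolding cmod_eq_iff[symmetric] by simp
qed

text \<open>The difference of the two feet is (b - c) (1 - a cnj d) / 2.\<close>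
lemma chord_foot_distinct:
  assumes "cmod a = 1" "cmod d \<noteq> 1" "b \<noteq> c"
  shows "chord_foot d a b \<noteq> chord_foot d a c"
proof
  assume "chord_foot d a b = chord_foot d a c"
  then have "(b - c) * (1 - a * cnj d) = 0" unfolding chord_foot_def by simp algebra
  then have "a * cnj d = 1" using assms by simp
  then have "cmod (a * cnj d) = 1" by (metis norm_one)
  then show False using assms by (simp add: norm_mult)
qed

section \<open>Pedal circles of inscribed triangles\<close>

definition chart :: "point \<Rightarrow> real \<Rightarrow> point \<Rightarrow> complex" where
  "chart m R P = Complex ((P$1 - m$1) / R) ((P$2 - m$2) / R)"

lemma dist_chart:
  assumes "0 < R"
  shows "dist (chart m R P) (chart m R Q) = dist P Q / R"
proof -
  have "dist (chart m R P) (chart m R Q) = sqrt (((P$1 - Q$1) / R)\<^sup>2 + ((P$2 - Q$2) / R)\<^sup>2)"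
    by (simp add: dist_norm cmod_def chart_def flip: diff_divide_distrib)
  also have "\<dots> = sqrt (((P$1 - Q$1)\<^sup>2 + (P$2 - Q$2)\<^sup>2) / R\<^sup>2)"
    by (simp add: power_divide add_divide_distrib)
  also have "\<dots> = dist P Q / R"
    using assms by (simp add: real_sqrt_divide dist_norm norm_eq_sqrt_inner inner_vec_def sum_2 power2_eq_square)
  finally show ?thesis .
qed

lemma chart_eq_iff: "0 < R \<Longrightarrow> chart m R P = chart m R Q \<longleftrightarrow> P = Q"
  using dist_chart[of R m P Q] by (metis dist_eq_0_iff divide_eq_0_iff less_irrefl)

lemma chart_surj: "0 < R \<Longrightarrow> \<exists>P. chart m R P = w"
  by (rule exI[of _ "vector [m$1 + R * Re w, m$2 + R * Im w]"])
    (simp add: chart_def complex_eq_iff)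

lemma chart_sphere_iff:
  assumes "0 < R"
  shows "P \<in> sphere m R \<longleftrightarrow> cmod (chart m R P) = 1"
proof -
  have "chart m R m = 0" by (simp add: chart_def zero_complex.code)
  then have "cmod (chart m R P) = dist m P / R"
    using dist_chart[OF assms, of m m P] by simp
  then show ?thesis using assms by (simp add: divide_eq_eq)
qed

lemma chart_inner:
  assumes "R \<noteq> 0"
  shows "complex_of_real (2 * ((P - Q) \<bullet> (S - T))) = (of_real R)\<^sup>2 *
    ((chart m R P - chart m R Q) * cnj (chart m R S - chart m R T) +
     cnj (chart m R P - chart m R Q) * (chart m R S - chart m R T))"
  using assms
  by (simp add: complex_eq_iff chart_def inner_vec_def sum_2 power2_eq_square field_simps)

lemma chart_foot:
  assumes "0 < R" "A \<in> sphere m R" "B \<in> sphere m R" "A \<noteq> B"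
  shows "chart m R (foot D A B) = chord_foot (chart m R D) (chart m R A) (chart m R B)"
proof -
  define a b d where "a = chart m R A" and "b = chart m R B" and "d = chart m R D"
  have a: "a * cnj a = 1" and b: "b * cnj b = 1" 
    using assms chart_sphere_iff unit_cnj by (auto simp: a_def b_def)
  have ab: "(b - a) * cnj (b - a) \<noteq> 0" using assms chart_eq_iff by (auto simp: a_def b_def)
  define t where "t = ((D - A) \<bullet> (B - A)) / ((B - A) \<bullet> (B - A))"
  have F: "foot D A B = A + t *\<^sub>R (B - A)" using foot_props(1)[OF assms(4)] t_def by simp
  have cF: "chart m R (foot D A B) = a + of_real t * (b - a)"
    using assms(1) by (simp add: F chart_def a_def b_def complex_eq_iff field_simps)
  have "t * (2 * ((B - A) \<bullet> (B - A))) = 2 * ((D - A) \<bullet> (B - A))"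
    using assms(4) by (simp add: t_def)
  then have "of_real t * complex_of_real (2 * ((B - A) \<bullet> (B - A))) = of_real (2 * ((D - A) \<bullet> (B - A)))"
    by (metis of_real_mult)
  then have "(of_real R)\<^sup>2 * (of_real t * (2 * ((b - a) * cnj (b - a)))) =
    (of_real R)\<^sup>2 * ((d - a) * cnj (b - a) + cnj (d - a) * (b - a))"
    unfolding chart_inner[OF less_imp_neq[OF assms(1), symmetric], of _ _ _ _ m] a_def b_def d_def
    by algebra
  then have "of_real t * (2 * ((b - a) * cnj (b - a))) =
    (d - a) * cnj (b - a) + cnj (d - a) * (b - a)"
    using assms(1) by simp
  then have "((b - a) * cnj (b - a)) * (2 * (a + of_real t * (b - a))) =
    ((b - a) * cnj (b - a)) * (d + a + b - a * b * cnj d)"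
    using a b by simp algebra
  then have "2 * (a + of_real t * (b - a)) = d + a + b - a * b * cnj d"
    using ab mult_cancel_left by blast
  then show ?thesis by (simp add: cF chord_foot_def a_def b_def d_def eq_divide_eq mult.commute)
qed

definition focal_circle :: "point \<Rightarrow> real \<Rightarrow> point \<Rightarrow> complex \<Rightarrow> point set" where
  "focal_circle m R D z = {P. on_focal (chart m R D) z (chart m R P)}"

lemma focal_circle_sphere:
  assumes "0 < R"
  shows "\<exists>c \<rho>. focal_circle m R D z = sphere c \<rho>"
proof -
  obtain c where c: "chart m R c = (chart m R D + z) / 2" using chart_surj[OF assms] by blast
  define q where "q = cmod (1 - cnj (chart m R D) * z)"
  have "P \<in> focal_circle m R D z \<longleftrightarrow> P \<in> sphere c (q * R / 2)" for P
  proof -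
    have "2 * chart m R P - chart m R D - z = 2 * (chart m R P - chart m R c)"
      by (simp add: c del: distrib_left_numeral)
    then have "P \<in> focal_circle m R D z \<longleftrightarrow> 2 * dist (chart m R P) (chart m R c) = q"
      unfolding focal_circle_def on_focal_def q_def dist_norm mem_Collect_eq
      by (simp only: norm_mult norm_numeral)
    then show ?thesis 
      using assms by (simp add: dist_chart[OF assms] dist_commute field_simps)
  qed
  then show ?thesis by blast
qed

text \<open>A circle is the pedal circle as soon as it contains the three feet: D being off
  the circumcircle, the feet are distinct, and three distinct points of a circle determine it.\<close>
lemma pedal_circle_eqI:
  assumes R: "0 < R" and on: "{A, B, C} \<subseteq> sphere m R" and dist: "A \<noteq> B" "B \<noteq> C" "C \<noteq> A"
    and D: "D \<notin> sphere m R"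
    and feet: "{foot D B C, foot D C A, foot D A B} \<subseteq> focal_circle m R D z"
  shows "pedal_circle D A B C = focal_circle m R D z"
proof -
  obtain c \<rho> where E: "focal_circle m R D z = sphere c \<rho>" using focal_circle_sphere[OF R] by blast
  have ne: "foot D X Y \<noteq> foot D X Z" if "X \<in> {A, B, C}" "Y \<in> {A, B, C}" "Z \<in> {A, B, C}"
    "X \<noteq> Y" "Y \<noteq> Z" "Z \<noteq> X" for X Y Z
  proof -
    have XYZ: "X \<in> sphere m R" "Y \<in> sphere m R" "Z \<in> sphere m R"
      using that(1-3) on by blast+
    have "chord_foot (chart m R D) (chart m R X) (chart m R Y)
        \<noteq> chord_foot (chart m R D) (chart m R X) (chart m R Z)"
    proof (rule chord_foot_distinct)
      show "cmod (chart m R X) = 1" "cmod (chart m R D) \<noteq> 1"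
        using XYZ(1) D by (simp_all add: chart_sphere_iff[OF R] del: mem_sphere)
      show "chart m R Y \<noteq> chart m R Z" using that(5) by (simp add: chart_eq_iff[OF R])
    qed
    then show ?thesis
      using chart_foot[OF R XYZ(1,2) that(4)] chart_foot[OF R XYZ(1,3) that(6)[symmetric]]
      by metis
  qed
  have ne3: "foot D B C \<noteq> foot D C A" "foot D C A \<noteq> foot D A B" "foot D A B \<noteq> foot D B C"
    using ne[of C B A] ne[of A C B] ne[of B A C] dist
    by (simp_all add: foot_commute[of D C B] foot_commute[of D C A] foot_commute[of D B A])
  have "0 < \<rho>"
  proof (rule ccontr)
    assume "\<not> 0 < \<rho>"
    moreover have "dist c (foot D B C) = \<rho>" "dist c (foot D C A) = \<rho>"
      using feet unfolding E by simp_all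
    ultimately have "dist c (foot D B C) = 0" "dist c (foot D C A) = 0"
      using zero_le_dist[of c "foot D B C"] by linarith+
    then show False using ne3(1) by simp
  qed
  then show ?thesis unfolding pedal_circle_def E
    using feet ne3 by (intro circumcircle_eqI) (auto simp: E)
qed

lemma pedal_circle_inscribed:
  assumes R: "0 < R" and on: "{A, B, C} \<subseteq> sphere m R" and dist: "A \<noteq> B" "B \<noteq> C" "C \<noteq> A"
    and D: "D \<notin> sphere m R"
  obtains z where "pedal_circle D A B C = focal_circle m R D z"
    "{foot D B C, foot D C A, foot D A B} \<subseteq> focal_circle m R D z"
    "cmod z = 1 \<longrightarrow> D \<in> side_line A B \<union> side_line B C \<union> side_line C A"
proof -
  define a b c d where "a = chart m R A" and "b = chart m R B" and "c = chart m R C" and "d = chart m R D"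
  have u: "cmod a = 1" "cmod b = 1" "cmod c = 1" "cmod d \<noteq> 1"
    using on D chart_sphere_iff[OF R] by (auto simp: a_def b_def c_def d_def)
  have feet: "chart m R (foot D B C) = chord_foot d b c" "chart m R (foot D C A) = chord_foot d c a"
    "chart m R (foot D A B) = chord_foot d a b"
    using chart_foot[OF R] on dist by (auto simp: a_def b_def c_def d_def)
  obtain z where z: "d + z + a * b * c * cnj d * cnj z = a + b + c"
    using isogonal_conjugate_exists[of "a * b * c" d "a + b + c"] u by (auto simp: norm_mult)
  have "on_focal d z (chord_foot d b c)" "on_focal d z (chord_foot d c a)" "on_focal d z (chord_foot d a b)"
    using focal_of_triangle[of a b c d z] focal_of_triangle[of b c a d z] focal_of_triangle[of c a b d z] u z
    by (simp_all add: ac_simps)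
  then have in_focal: "{foot D B C, foot D C A, foot D A B} \<subseteq> focal_circle m R D z"
    using feet by (simp add: focal_circle_def flip: d_def)
  have "D \<in> side_line A B \<union> side_line B C \<union> side_line C A" if "cmod z = 1"
  proof -
    have "chart m R (foot D B C) = chart m R D \<or> chart m R (foot D C A) = chart m R D
        \<or> chart m R (foot D A B) = chart m R D"
      using conjugate_on_circle[OF u(1-3) that z] by (simp only: feet flip: d_def)
    then have "foot D B C = D \<or> foot D C A = D \<or> foot D A B = D"
      by (simp only: chart_eq_iff[OF R])
    then show ?thesis
      using foot_props(3)[OF dist(1), of D] foot_props(3)[OF dist(2), of D]
        foot_props(3)[OF dist(3), of D] by auto
  qed
  then show ?thesis using that[OF pedal_circle_eqI[OF R on dist D in_focal] in_focal] by simp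
qed

section \<open>Polars and inversion\<close>

lemma polar_iff:
  assumes "P \<noteq> D"
  shows "X \<in> polar D r P \<longleftrightarrow> (X - D) \<bullet> (P - D) = r\<^sup>2"
proof -
  have "(X - inversion D r P) \<bullet> (P - D) = (X - D) \<bullet> (P - D) - r\<^sup>2 / (dist D P)\<^sup>2 * ((P - D) \<bullet> (P - D))"
    by (simp only: inversion_def diff_add_eq_diff_diff_swap inner_diff_left inner_scaleR_left)
  also have "(P - D) \<bullet> (P - D) = (dist D P)\<^sup>2"
    by (metis dist_commute dist_norm power2_norm_eq_inner)
  finally show ?thesis using assms by (simp add: polar_def)
qed

lemma inversion_neq_center: "r \<noteq> 0 \<Longrightarrow> P \<noteq> D \<Longrightarrow> inversion D r P \<noteq> D"
  by (simp add: inversion_def)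

lemma inversion_involution:
  assumes "r \<noteq> 0" "P \<noteq> D"
  shows "inversion D r (inversion D r P) = P"
proof -
  have "dist D (inversion D r P) = r\<^sup>2 / (dist D P)\<^sup>2 * dist D P"
    by (simp add: inversion_def dist_norm norm_minus_commute)
  then have "r\<^sup>2 / (dist D (inversion D r P))\<^sup>2 * (r\<^sup>2 / (dist D P)\<^sup>2) = 1"
    using assms by (simp add: power2_eq_square field_simps)
  moreover have "inversion D r (inversion D r P) =
      D + (r\<^sup>2 / (dist D (inversion D r P))\<^sup>2 * (r\<^sup>2 / (dist D P)\<^sup>2)) *\<^sub>R (P - D)"
    by (simp add: inversion_def[of D r "inversion D r P"]) (simp add: inversion_def)
  ultimately show ?thesis by (simp only: scaleR_one add_diff_cancel_left' add.commute) simp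
qed

lemma polar_commute:
  "P \<noteq> D \<Longrightarrow> Q \<noteq> D \<Longrightarrow> P \<in> polar D r Q \<longleftrightarrow> Q \<in> polar D r P"
  by (simp add: polar_iff inner_commute)

lemma polar_inversion_iff:
  assumes "r \<noteq> 0" "F \<noteq> D"
  shows "X \<in> polar D r (inversion D r F) \<longleftrightarrow> (X - F) \<bullet> (F - D) = 0"
proof -
  have "inversion D r F - D = (r\<^sup>2 / (dist D F)\<^sup>2) *\<^sub>R (F - D)" by (simp add: inversion_def)
  then show ?thesis
    using assms by (simp add: polar_def inversion_involution)
qed

lemma in_inverse_curve_iff:
  "P \<in> inverse_curve D r S \<longleftrightarrow> (\<exists>F. F \<in> S \<and> F \<noteq> D \<and> P = inversion D r F)"
  by (auto simp: inverse_curve_def)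

lemma doubleton_eqI:
  assumes "A \<in> S" "B \<in> S" "A \<noteq> B"
    and "\<And>X Y Z. \<lbrakk>X \<in> S; Y \<in> S; Z \<in> S\<rbrakk> \<Longrightarrow> X = Y \<or> X = Z \<or> Y = Z"
  shows "S = {A, B}"
proof
  show "S \<subseteq> {A, B}" using assms(4)[OF assms(1,2)] assms(3) by blast
  show "{A, B} \<subseteq> S" using assms(1,2) by blast
qed

lemma doubletonI:
  assumes "A \<in> S" "\<And>X Y Z. \<lbrakk>X \<in> S; Y \<in> S; Z \<in> S\<rbrakk> \<Longrightarrow> X = Y \<or> X = Z \<or> Y = Z"
  shows "\<exists>B. S = {A, B}"
proof (cases "S = {A}")
  case False
  then obtain B where "B \<in> S" "B \<noteq> A" using assms(1) by blast
  then have "S = {A, B}" using assms by (intro doubleton_eqI) blast+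
  then show ?thesis ..
qed auto

lemma polar_sphere_no_three:
  assumes "P \<noteq> D" "{X, Y, Z} \<subseteq> polar D r P \<inter> sphere c \<rho>"
  shows "X = Y \<or> X = Z \<or> Y = Z"
  using assms by (intro sphere_line_no_three[of "P - D" X c \<rho> Y Z]) 
    (auto simp: polar_def inner_diff_left)

text \<open>Inversion carries the polar of A to the circle with diameter DA. This circle passes
  through D, so it differs from any circle that does not, and has at most two points in common
  with it.\<close>
lemma polar_inverse_no_three:
  assumes "r \<noteq> 0" "A \<noteq> D" "D \<notin> sphere c \<rho>"
    and XYZ: "{X, Y, Z} \<subseteq> polar D r A \<inter> inverse_curve D r (sphere c \<rho>)"
  shows "X = Y \<or> X = Z \<or> Y = Z"
proof -
  define c' \<rho>' where "c' = (1/2) *\<^sub>R (A + D)" and "\<rho>' = dist A D / 2"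
  have D': "D \<in> sphere c' \<rho>'"
  proof -
    have "c' - D = (1/2) *\<^sub>R (A - D)" by (simp add: c'_def vec_eq_iff field_simps)
    then show ?thesis by (simp add: dist_norm \<rho>'_def)
  qed
  have ex: "\<exists>F \<in> sphere c \<rho> \<inter> sphere c' \<rho>'. W = inversion D r F"
    if W: "W \<in> {X, Y, Z}" for W
  proof -
    obtain F where F: "F \<in> sphere c \<rho>" "F \<noteq> D" "W = inversion D r F"
      using subsetD[OF XYZ W] unfolding inverse_curve_def by blast
    have "inversion D r F \<in> polar D r A" using subsetD[OF XYZ W] F(3) by simp
    then have "A \<in> polar D r (inversion D r F)"
      using polar_commute[OF inversion_neq_center[OF assms(1) F(2)] assms(2)] by simp
    then have "(A - F) \<bullet> (F - D) = 0" using polar_inversion_iff[OF assms(1) F(2)] by simp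
    moreover have "A - F = (c' - F) + (c' - D)" "F - D = (c' - D) - (c' - F)"
      by (simp_all add: c'_def vec_eq_iff field_simps)
    ultimately have "((c' - F) + (c' - D)) \<bullet> ((c' - D) - (c' - F)) = 0" by metis
    then have "(norm (c' - F))\<^sup>2 = (norm (c' - D))\<^sup>2"
      unfolding power2_norm_eq_inner inner_add_left inner_diff_right[of _ "c' - D" "c' - F"]
      by (simp only: inner_commute[of "c' - D" "c' - F"])
    then have "F \<in> sphere c' \<rho>'" using D' by (simp add: dist_norm)
    then show ?thesis using F by blast
  qed
  obtain F1 where F1: "F1 \<in> sphere c \<rho> \<inter> sphere c' \<rho>'" "X = inversion D r F1"
    using ex[of X] by blast
  obtain F2 where F2: "F2 \<in> sphere c \<rho> \<inter> sphere c' \<rho>'" "Y = inversion D r F2"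
    using ex[of Y] by blast
  obtain F3 where F3: "F3 \<in> sphere c \<rho> \<inter> sphere c' \<rho>'" "Z = inversion D r F3"
    using ex[of Z] by blast
  have "c \<noteq> c'" using F1(1) D' assms(3) by auto
  then have "F1 = F2 \<or> F1 = F3 \<or> F2 = F3"
    using two_spheres_no_three[OF F1(1) F2(1) F3(1)] by blast
  then show ?thesis using F1(2) F2(2) F3(2) by blast
qed

section \<open>Triangles with a common circumcircle and pedal circle\<close>

theorem mainTheorem4:
  fixes T1 T2 T3 D :: point and r :: real and K E E' :: "point set"
  assumes triangle: "is_triangle T1 T2 T3"
    and K: "K = circumcircle T1 T2 T3"
    and D_sides: "D \<notin> side_line T1 T2" "D \<notin> side_line T2 T3" "D \<notin> side_line T3 T1"
    and D_circ: "D \<notin> K"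
    and E: "E = pedal_circle D T1 T2 T3"
    and r: "r > 0"
    and E': "E' = inverse_curve D r E"
  shows
    "(\<forall>A\<in>K.
        (polar D r A \<inter> E' = {} \<longrightarrow>
           \<not> (\<exists>B C. is_triangle A B C \<and> circumcircle A B C = K \<and> pedal_circle D A B C = E)) \<and>
        (polar D r A \<inter> E' \<noteq> {} \<longrightarrow>
           (\<exists>Bp Cp. polar D r A \<inter> E' = {Bp, Cp}) \<and>
           (\<forall>Bp Cp. polar D r A \<inter> E' = {Bp, Cp} \<longrightarrow>
              A \<in> polar D r Bp \<and> A \<in> polar D r Cp \<and>
              (\<exists>B C. polar_construction D r K E' A Bp Cp B C) \<and>
              (\<forall>B C. polar_construction D r K E' A Bp Cp B C \<and>
                      Bp \<noteq> Cp \<and> B \<noteq> A \<and> C \<noteq> A \<longrightarrow>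
                 is_triangle A B C \<and> circumcircle A B C = K \<and> pedal_circle D A B C = E)))) \<and>
     (\<forall>A B C. is_triangle A B C \<and> circumcircle A B C = K \<and> pedal_circle D A B C = E \<longrightarrow>
        (\<exists>Bp Cp. Bp \<noteq> Cp \<and> polar_construction D r K E' A Bp Cp B C))"
proof -
  have tri_on: "\<exists>m R. 0 < R \<and> circumcircle A B C = sphere m R \<and> {A, B, C} \<subseteq> sphere m R \<and>
      A \<noteq> B \<and> B \<noteq> C \<and> C \<noteq> A" if ABC: "is_triangle A B C" for A B C
  proof -
    obtain m R where mR: "0 < R" "{A, B, C} \<subseteq> sphere m R"
      using triangle_on_sphere(4)[OF ABC] by blast
    show ?thesis
    proof (intro exI conjI)
      show "circumcircle A B C = sphere m R"
        using circumcircle_eqI[OF mR triangle_on_sphere(1-3)[OF ABC]] .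
    qed (fact mR triangle_on_sphere(1-3)[OF ABC])+
  qed
  obtain m R where R: "0 < R" and Km': "circumcircle T1 T2 T3 = sphere m R"
    and T: "{T1, T2, T3} \<subseteq> sphere m R" "T1 \<noteq> T2" "T2 \<noteq> T3" "T3 \<noteq> T1"
    using tri_on[OF triangle] by (elim exE conjE)
  have Km: "K = sphere m R" using Km' K by simp
  have D: "D \<notin> sphere m R" using D_circ Km by simp
  have rn: "r \<noteq> 0" using r by simp
  obtain z where Ez: "pedal_circle D T1 T2 T3 = focal_circle m R D z"
    and "{foot D T2 T3, foot D T3 T1, foot D T1 T2} \<subseteq> focal_circle m R D z"
    and z: "cmod z = 1 \<longrightarrow> D \<in> side_line T1 T2 \<union> side_line T2 T3 \<union> side_line T3 T1"
    using pedal_circle_inscribed[OF R T D] .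
  have Ez: "E = focal_circle m R D z" using Ez E by simp
  have z: "cmod z \<noteq> 1" using z D_sides by blast
  obtain e \<rho> where Es: "E = sphere e \<rho>" using focal_circle_sphere[OF R] Ez by blast
  have DE: "D \<notin> E"
  proof
    assume "D \<in> E"
    then have "on_focal (chart m R D) z (chart m R D)" by (simp add: Ez focal_circle_def)
    then have "cmod (chart m R D) = 1" using on_focal_self z by blast
    then show False using D unfolding chart_sphere_iff[OF R] by contradiction
  qed
  have foot_E: "foot D X Y \<in> E \<longleftrightarrow>
      on_focal (chart m R D) z (chord_foot (chart m R D) (chart m R X) (chart m R Y))"
    if "X \<in> sphere m R" "Y \<in> sphere m R" "X \<noteq> Y" for X Y
    by (simp only: Ez focal_circle_def mem_Collect_eq chart_foot[OF R that])
  have AD: "A \<noteq> D" if "A \<in> K" for A using that D_circ by auto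
  have E'D: "P \<noteq> D" if "P \<in> E'" for P
    using that inversion_neq_center[OF rn] unfolding E' in_inverse_curve_iff by metis

  have secant: "X = Y \<or> X = Z \<or> Y = Z"
    if "P \<noteq> D" "X \<in> polar D r P \<inter> K" "Y \<in> polar D r P \<inter> K" "Z \<in> polar D r P \<inter> K"
    for P X Y Z
    using polar_sphere_no_three[OF that(1), of X Y Z r m R] that(2-4) by (simp add: Km)
  have poles_no_three: "X = Y \<or> X = Z \<or> Y = Z"
    if "A \<in> K" "X \<in> polar D r A \<inter> E'" "Y \<in> polar D r A \<inter> E'" "Z \<in> polar D r A \<inter> E'"
    for A X Y Z
  proof (rule polar_inverse_no_three[OF rn AD[OF that(1)]])
    show "D \<notin> sphere e \<rho>" using DE Es by simp
    show "{X, Y, Z} \<subseteq> polar D r A \<inter> inverse_curve D r (sphere e \<rho>)"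
      using that(2-4) E' Es by simp
  qed

  \<comment> \<open>A point of the inverted pedal circle is a pole of a chord A X only if it is the inverse of the
    foot on that chord.\<close>
  have side: "foot D A X \<in> E \<and> inversion D r (foot D A X) = P" 
    if "P \<in> E'" "polar D r P \<inter> K = {A, X}" "A \<noteq> X" for A X P
  proof -
    obtain F where F: "F \<in> E" "F \<noteq> D" "P = inversion D r F"
      using \<open>P \<in> E'\<close> unfolding E' in_inverse_curve_iff by blast
    have "A \<in> polar D r P" "X \<in> polar D r P" using that(2) by blast+
    then have "(A - F) \<bullet> (F - D) = 0" "(X - F) \<bullet> (F - D) = 0"
      using polar_inversion_iff[OF rn F(2)] F(3) by blast+
    then have "foot D A X = F" using foot_eqI_orthogonal[of A X F D] that(3) F(2) by simp
    then show ?thesis using F by blast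
  qed

  have sound: "is_triangle A B C \<and> circumcircle A B C = K \<and> pedal_circle D A B C = E"
    if con: "polar_construction D r K E' A Bp Cp B C" and ne: "Bp \<noteq> Cp" "B \<noteq> A" "C \<noteq> A"
    for A B C Bp Cp
  proof -
    have Bp: "Bp \<in> E'" "polar D r Bp \<inter> K = {A, C}" and Cp: "Cp \<in> E'" "polar D r Cp \<inter> K = {A, B}"
      using con unfolding polar_construction_def by blast+
    have on: "{A, B, C} \<subseteq> sphere m R" using Bp Cp Km by blast
    have fB: "foot D A C \<in> E" "inversion D r (foot D A C) = Bp"
      and fC: "foot D A B \<in> E" "inversion D r (foot D A B) = Cp"
      using side[OF Bp ne(3)[symmetric]] side[OF Cp ne(2)[symmetric]] by simp_all
    \<comment> \<open>Otherwise both poles come from the same chord.\<close>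
    have BC: "B \<noteq> C" using fB(2) fC(2) ne(1) by blast
    have on': "A \<in> sphere m R" "B \<in> sphere m R" "C \<in> sphere m R" using on by simp_all
    have "on_focal (chart m R D) z (chord_foot (chart m R D) (chart m R B) (chart m R C))"
    proof (rule focal_closure[of "chart m R A"])
      show "on_focal (chart m R D) z (chord_foot (chart m R D) (chart m R A) (chart m R B))"
        using fC(1) foot_E[OF on'(1,2) ne(2)[symmetric]] by blast
      show "on_focal (chart m R D) z (chord_foot (chart m R D) (chart m R A) (chart m R C))"
        using fB(1) foot_E[OF on'(1,3) ne(3)[symmetric]] by blast
      show "cmod (chart m R A) = 1" "cmod (chart m R B) = 1" "cmod (chart m R C) = 1"
        "cmod (chart m R D) \<noteq> 1"
        using on' D chart_sphere_iff[OF R] by blast+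
      show "chart m R B \<noteq> chart m R C" using BC by (simp add: chart_eq_iff[OF R])
    qed (rule z)
    then have "foot D B C \<in> E" using foot_E[OF on'(2,3) BC] by blast
    then have "pedal_circle D A B C = E" unfolding Ez
      using fB(1) fC(1) \<open>foot D B C \<in> E\<close> foot_commute[of D A C]
      by (intro pedal_circle_eqI[OF R on ne(2)[symmetric] BC ne(3) D]) (simp flip: Ez)
    moreover have "is_triangle A B C"
      using not_collinear_on_sphere[OF on ne(2)[symmetric] BC ne(3)] .
    moreover have "circumcircle A B C = K"
      using circumcircle_eqI[OF R on ne(2)[symmetric] BC ne(3)] Km by simp
    ultimately show ?thesis by blast
  qed

  have complete: "\<exists>Bp Cp. Bp \<noteq> Cp \<and> polar_construction D r K E' A Bp Cp B C"
    if tri: "is_triangle A B C" "circumcircle A B C = K" "pedal_circle D A B C = E" for A B C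
  proof -
    note ne = triangle_on_sphere(1-3)[OF tri(1)]
    from tri_on[OF tri(1)] have on: "{A, B, C} \<subseteq> sphere m R"
      unfolding tri(2) Km by (elim exE conjE) simp
    obtain z' where "pedal_circle D A B C = focal_circle m R D z'"
      "{foot D B C, foot D C A, foot D A B} \<subseteq> focal_circle m R D z'"
      "cmod z' = 1 \<longrightarrow> D \<in> side_line A B \<union> side_line B C \<union> side_line C A"
      using pedal_circle_inscribed[OF R on ne D] .
    then have feet: "foot D A C \<in> E" "foot D A B \<in> E"
      using tri(3) foot_commute[of D A C] by simp_all
    have pole: "inversion D r (foot D A X) \<in> polar D r A \<inter> E'
        \<and> polar D r (inversion D r (foot D A X)) \<inter> K = {A, X}"
      if X: "X \<in> {B, C}" for X
    proof -
      define F where "F = foot D A X"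
      have F: "F \<in> E" using X feet unfolding F_def by blast
      \<comment> \<open>A side through D would have D itself as its foot, but D is not on the pedal circle.\<close>
      then have FD: "F \<noteq> D" using DE by blast
      have AX: "A \<noteq> X" "A \<in> K" "X \<in> K"
        using X on ne unfolding Km by auto
      have perp: "(D - F) \<bullet> (X - A) = 0" using foot_props(2)[OF AX(1)] F_def by blast
      obtain u where u: "F = A + u *\<^sub>R (X - A)"
        using foot_props(3)[OF AX(1), of D] by (auto simp: F_def side_line_def affine_hull_2_alt)
      have "A - F = (- u) *\<^sub>R (X - A)" "X - F = (1 - u) *\<^sub>R (X - A)"
        by (simp_all add: u algebra_simps)
      then have "(A - F) \<bullet> (F - D) = 0" "(X - F) \<bullet> (F - D) = 0"
        using perp by (simp_all add: inner_commute inner_diff_left inner_diff_right)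
      then have P: "{A, X} \<subseteq> polar D r (inversion D r F)"
        using polar_inversion_iff[OF rn FD] by blast
      have "inversion D r F \<in> E'" using F FD unfolding E' in_inverse_curve_iff by blast
      moreover have "inversion D r F \<in> polar D r A"
        using P polar_commute[OF AD[OF AX(2)] inversion_neq_center[OF rn FD]] by simp
      moreover have "polar D r (inversion D r F) \<inter> K = {A, X}"
      proof (rule doubleton_eqI[OF _ _ AX(1)])
        show "A \<in> polar D r (inversion D r F) \<inter> K" "X \<in> polar D r (inversion D r F) \<inter> K"
          using P AX(2,3) by simp_all
      qed (rule secant[OF inversion_neq_center[OF rn FD]])
      ultimately show ?thesis by (simp add: F_def)
    qed
    define Bp Cp where "Bp = inversion D r (foot D A C)" and "Cp = inversion D r (foot D A B)"
    have p: "Bp \<in> polar D r A \<inter> E'" "polar D r Bp \<inter> K = {A, C}"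
      "Cp \<in> polar D r A \<inter> E'" "polar D r Cp \<inter> K = {A, B}"
      using pole[of C] pole[of B] unfolding Bp_def Cp_def by simp_all
    have "Bp \<noteq> Cp"
    proof
      assume "Bp = Cp"
      then have "{A, C} = {A, B}" using p(2,4) by simp
      then show False using ne by (simp add: doubleton_eq_iff)
    qed
    moreover have "polar D r A \<inter> E' = {Bp, Cp}"
    proof (rule doubleton_eqI[OF p(1,3) calculation])
      have "A \<in> K" using on Km by simp
      then show "X = Y \<or> X = Z \<or> Y = Z" if "X \<in> polar D r A \<inter> E'" "Y \<in> polar D r A \<inter> E'"
        "Z \<in> polar D r A \<inter> E'" for X Y Z
        using poles_no_three that by metis
    qed
    ultimately have "Bp \<noteq> Cp \<and> polar_construction D r K E' A Bp Cp B C"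
      using p(2,4) by (simp add: polar_construction_def)
    then show ?thesis by blast
  qed

  have two: "\<exists>Bp Cp. polar D r A \<inter> E' = {Bp, Cp}" if A: "A \<in> K" "polar D r A \<inter> E' \<noteq> {}" for A
  proof -
    obtain P where "P \<in> polar D r A \<inter> E'" using A(2) by blast
    then have "\<exists>Q. polar D r A \<inter> E' = {P, Q}"
      using poles_no_three[OF A(1)] by (rule doubletonI)
    then show ?thesis by blast
  qed

  have second: "A \<in> polar D r P \<and> (\<exists>X. polar D r P \<inter> K = {A, X})"
    if "A \<in> K" "P \<in> polar D r A \<inter> E'" for A P
  proof -
    have PD: "P \<noteq> D" using that(2) E'D by blast
    then have AP: "A \<in> polar D r P" using that(2) polar_commute[OF AD[OF that(1)] PD] by simp
    then have "A \<in> polar D r P \<inter> K" using that(1) by simp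
    then have "\<exists>X. polar D r P \<inter> K = {A, X}" using secant[OF PD] by (rule doubletonI)
    with AP show ?thesis by blast
  qed

  show ?thesis
  proof (intro conjI ballI impI allI)
    fix A assume empty: "polar D r A \<inter> E' = {}"
    show "\<not> (\<exists>B C. is_triangle A B C \<and> circumcircle A B C = K \<and> pedal_circle D A B C = E)"
    proof
      assume "\<exists>B C. is_triangle A B C \<and> circumcircle A B C = K \<and> pedal_circle D A B C = E"
      then obtain B C where "is_triangle A B C" "circumcircle A B C = K" "pedal_circle D A B C = E"
        by blast
      from complete[OF this] obtain Bp Cp where "polar_construction D r K E' A Bp Cp B C"
        by blast
      then show False using empty by (simp add: polar_construction_def)
    qed
  next
    fix A Bp Cp assume A: "A \<in> K" and poles: "polar D r A \<inter> E' = {Bp, Cp}"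
    have B: "A \<in> polar D r Bp \<and> (\<exists>C. polar D r Bp \<inter> K = {A, C})"
      and C: "A \<in> polar D r Cp \<and> (\<exists>B. polar D r Cp \<inter> K = {A, B})"
      using second[OF A, of Bp] second[OF A, of Cp] poles by simp_all
    show "A \<in> polar D r Bp" "A \<in> polar D r Cp" using B C by simp_all
    show "\<exists>B C. polar_construction D r K E' A Bp Cp B C"
      using B C poles unfolding polar_construction_def by simp
  next
    fix A assume "A \<in> K" "polar D r A \<inter> E' \<noteq> {}"
    then show "\<exists>Bp Cp. polar D r A \<inter> E' = {Bp, Cp}" by (rule two)
  next
    fix A Bp Cp B C
    assume "polar_construction D r K E' A Bp Cp B C \<and> Bp \<noteq> Cp \<and> B \<noteq> A \<and> C \<noteq> A"
    then show "is_triangle A B C" "circumcircle A B C = K" "pedal_circle D A B C = E"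
      using sound[of A Bp Cp B C] by simp_all
  next
    fix A B C
    assume "is_triangle A B C \<and> circumcircle A B C = K \<and> pedal_circle D A B C = E"
    then show "\<exists>Bp Cp. Bp \<noteq> Cp \<and> polar_construction D r K E' A Bp Cp B C"
      using complete[of A B C] by simp
  qed
qed

end
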